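(* Let $N_{\mathrm{in}}$ be the in-degree of a typical node in the Poisson $i\mathcal{S}$-graph with legitimate-node density $\lambda_\ell>0$ and eavesdropper density $\lambda_{\mathrm e}>0$ (secrecy rate threshold zero, path loss only, equal noise powers). Let $\widetilde A$ denote the area of a typical Voronoi cell induced by a unit-density homogeneous Poisson process on $\mathbb{R}^2$. Then $N_{\mathrm{in}}$ has moment generating function $$M_{N_{\mathrm{in}}}(s)=\mathbb{E}\{e^{sN_{\mathrm{in}}}\}=\mathbb{E}\left\{\exp\left(\frac{\lambda_\ell}{\lambda_{\mathrm e}}\widetilde A\,(e^{s}-1)\right)\right\}.$$ Furthermore, all the moments of $N_{\mathrm{in}}$ are given by $$\mathbb{E}\{N_{\mathrm{in}}^{n}\}=\sum_{k=1}^{n}\left(\frac{\lambda_\ell}{\lambda_{\mathrm e}}\right)^{k}S(n,k)\,\mathbb{E}\{\widetilde A^{k}\},\qquad n\ge 1,$$ where $S(n,k)$, $1\le k\le n$, are the Stirling numbers of the second kind.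
   Context: Poisson $i\mathcal{S}$-graph (zero threshold, path loss only, equal noise powers): $\Pi_\ell$ (legitimate nodes) and $\Pi_{\mathrm e}$ (eavesdroppers) are mutually independent homogeneous Poisson point processes on $\mathbb{R}^2$ with densities $\lambda_\ell>0$ and $\lambda_{\mathrm e}>0$. There is a directed edge $\overrightarrow{xy}$ between distinct legitimate nodes $x,y$ if and only if the maximum secrecy rate of the link is positive, which in this setting is equivalent to $|x-y|<\min_{e\in\Pi_{\mathrm e}}|x-e|$, i.e. $y$ is closer to $x$ than every eavesdropper is. Typical node: the node at the origin when the graph is built on the legitimate-node set $\Pi_\ell\cup\{0\}$ (Slivnyak's theorem) with eavesdroppers $\Pi_{\mathrm e}$. Its in-degree $N_{\mathrm{in}}$ is the number of $x\in\Pi_\ell$ with an edge $\overrightarrow{x0}$. Typical Voronoi cell induced by a unit-density Poisson process $\widetilde\Pi$: the cell $\{y\in\mathbb{R}^2:|y|<|y-p|\ \forall p\in\widetilde\Pi\}$ of the point $0$ in $\widetilde\Pi\cup\{0\}$. Moment generating functions take values in $(0,\infty]$, $s\in\mathbb{R}$. *)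

theory Defs
  imports "HOL-Probability.Probability" "HOL-Combinatorics.Stirling"
begin

definition loc_finite :: "(real^2) set \<Rightarrow> bool" where
  "loc_finite S \<longleftrightarrow> (\<forall>B. bounded B \<longrightarrow> finite (S \<inter> B))"

text \<open>
  The measurable space of locally finite point configurations in the plane. Its \<open>\<sigma>\<close>-algebra is
  the usual one, generated by the counting maps \<open>S \<mapsto> card (S \<inter> B)\<close> with \<open>B\<close> bounded Borel.
\<close>
definition config_space :: "(real^2) set measure" where
  "config_space = sigma {S. loc_finite S}
     {{S. loc_finite S \<and> card (S \<inter> B) = k} | B k. B \<in> sets borel \<and> bounded B}"

text \<open>
  Homogeneous Poisson point process of density \<open>lam\<close>. The Poisson probabilities are written out
  because \<open>poisson_pmf\<close> needs a positive rate, whereas \<open>B\<close> may be a null set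
  (then the count is \<open>0\<close> almost surely, as \<open>0 ^ 0 = 1\<close>).
\<close>
definition poisson_process :: "'w measure \<Rightarrow> real \<Rightarrow> ('w \<Rightarrow> (real^2) set) \<Rightarrow> bool" where
  "poisson_process M lam \<Phi> \<longleftrightarrow>
     \<Phi> \<in> measurable M config_space \<and>
     (\<forall>B k. B \<in> sets borel \<and> bounded B \<longrightarrow>
        measure M {\<omega> \<in> space M. card (\<Phi> \<omega> \<inter> B) = k} =
          (lam * measure lborel B) ^ k / fact k * exp (- (lam * measure lborel B))) \<and>
     (\<forall>B :: nat \<Rightarrow> (real^2) set.
        (\<forall>i. B i \<in> sets borel \<and> bounded (B i)) \<and> disjoint_family B \<longrightarrow>
        prob_space.indep_vars M (\<lambda>_. count_space UNIV) (\<lambda>i \<omega>. card (\<Phi> \<omega> \<inter> B i)) UNIV)"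

text \<open>
  Edges of the secrecy graph on legitimate nodes \<open>L\<close> with eavesdroppers \<open>E\<close>, for zero rate
  threshold, path loss only and equal noise powers: the maximum secrecy rate from \<open>x\<close> to \<open>y\<close> is
  positive iff \<open>y\<close> is closer to \<open>x\<close> than every eavesdropper is. For \<open>E = {}\<close> the minimum distance
  to an eavesdropper is read as \<open>\<infinity>\<close>.
\<close>
definition iS_graph :: "(real^2) set \<Rightarrow> (real^2) set \<Rightarrow> ((real^2) \<times> (real^2)) set" where
  "iS_graph L E = {(x, y). x \<in> L \<and> y \<in> L \<and> x \<noteq> y \<and> (\<forall>e\<in>E. dist x y < dist x e)}"

definition in_neighbours :: "('v \<times> 'v) set \<Rightarrow> 'v \<Rightarrow> 'v set" where
  "in_neighbours G y = {x. (x, y) \<in> G}"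

definition typical_in_neighbours :: "(real^2) set \<Rightarrow> (real^2) set \<Rightarrow> (real^2) set" where
  "typical_in_neighbours L E = in_neighbours (iS_graph (insert 0 L) E) 0"

definition typical_in_degree :: "(real^2) set \<Rightarrow> (real^2) set \<Rightarrow> nat" where
  "typical_in_degree L E = card (typical_in_neighbours L E)"

definition typical_voronoi_cell :: "(real^2) set \<Rightarrow> (real^2) set" where
  "typical_voronoi_cell P = {y. \<forall>p\<in>P. norm y < norm (y - p)}"

definition typical_voronoi_area :: "(real^2) set \<Rightarrow> real" where
  "typical_voronoi_area P = measure lborel (typical_voronoi_cell P)"

text \<open>Expectation of a nonnegative random variable, with values in \<open>[0, \<infinity>]\<close>.\<close>
definition expect :: "'w measure \<Rightarrow> ('w \<Rightarrow> real) \<Rightarrow> ennreal" where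
  "expect M X = (\<integral>\<^sup>+ \<omega>. ennreal (X \<omega>) \<partial>M)"

definition mgf :: "'w measure \<Rightarrow> ('w \<Rightarrow> real) \<Rightarrow> real \<Rightarrow> ennreal" where
  "mgf M X s = expect M (\<lambda>\<omega>. exp (s * X \<omega>))"

end

theory Submission
  imports Defs "HOL-Real_Asymp.Real_Asymp"
begin

text \<open>
  An in-neighbour of \<open>0\<close> is a legitimate node other than \<open>0\<close> lying in the cell \<open>V\<close> of \<open>0\<close> among the
  eavesdroppers. By independence, given the eavesdroppers the in-degree is Poisson with mean
  \<open>lam_l * |V|\<close>, whose generating function and moments are classical. Since \<open>y \<in> V\<close> says that a
  closed disc contains no eavesdropper, \<open>|V|\<close> is measurable for the \<open>\<sigma>\<close>-algebra of void events, on
  which the void probabilities \<open>exp (- lam_e * |B|)\<close> alone determine the law; hence \<open>|V|\<close> has the law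
  of the unit-density area divided by \<open>lam_e\<close>. The cell is almost surely bounded because almost surely
  every open quadrant contains an eavesdropper.
\<close>

section \<open>Two sigma-algebras on configurations\<close>

text \<open>Void events are closed under intersection and so determine laws by a pi-system argument.
  The sigma-algebra is coarser than that of \<open>config_space\<close>, yet fine enough for the
  cell area.\<close>

definition void_space :: "(real^2) set measure" where
  "void_space = sigma {S. loc_finite S}
     {{S. loc_finite S \<and> S \<inter> B = {}} | B. B \<in> sets borel \<and> bounded B}"

lemma space_config_space [simp]: "space config_space = {S. loc_finite S}"
  unfolding config_space_def by (rule space_measure_of) auto

lemma space_void_space [simp]: "space void_space = {S. loc_finite S}"
  unfolding void_space_def by (rule space_measure_of) auto

lemma sets_void_space:
  "sets void_space = sigma_sets {S. loc_finite S}
     {{S. loc_finite S \<and> S \<inter> B = {}} | B. B \<in> sets borel \<and> bounded B}"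
  unfolding void_space_def by (rule sets_measure_of) auto

lemma loc_finiteD: "loc_finite S \<Longrightarrow> bounded B \<Longrightarrow> finite (S \<inter> B)"
  by (simp add: loc_finite_def)

lemma void_event_void_space:
  "B \<in> sets borel \<Longrightarrow> bounded B \<Longrightarrow> {S. loc_finite S \<and> S \<inter> B = {}} \<in> sets void_space"
  unfolding sets_void_space by blast

lemma count_event_config_space:
  "B \<in> sets borel \<Longrightarrow> bounded B \<Longrightarrow> {S. loc_finite S \<and> card (S \<inter> B) = k} \<in> sets config_space"
  unfolding config_space_def by (subst sets_measure_of) auto

lemma measurable_count:
  assumes "B \<in> sets borel" "bounded B"
  shows "(\<lambda>S. card (S \<inter> B)) \<in> measurable config_space (count_space UNIV)"
proof (subst measurable_count_space_eq2_countable, safe)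
  fix k
  have "(\<lambda>S. card (S \<inter> B)) -` {k} \<inter> space config_space = {S. loc_finite S \<and> card (S \<inter> B) = k}"
    by auto
  then show "(\<lambda>S. card (S \<inter> B)) -` {k} \<inter> space config_space \<in> sets config_space"
    using count_event_config_space[OF assms] by simp
qed auto

text \<open>Being void means having count 0. Local finiteness matters, as \<open>card\<close> is
  also 0 on infinite sets.\<close>

lemma measurable_config_void: "(\<lambda>S. S) \<in> measurable config_space void_space"
  unfolding void_space_def
proof (rule measurable_measure_of)
  fix X assume "X \<in> {{S. loc_finite S \<and> S \<inter> B = {}} | B. B \<in> sets borel \<and> bounded B}"
  then obtain B where B: "B \<in> sets borel" "bounded B" and X: "X = {S. loc_finite S \<and> S \<inter> B = {}}"
    by blast
  have "(\<lambda>S. S) -` X \<inter> space config_space = {S. loc_finite S \<and> card (S \<inter> B) = 0}"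
    unfolding X using loc_finiteD[OF _ B(2)] by auto
  then show "(\<lambda>S. S) -` X \<inter> space config_space \<in> sets config_space"
    using count_event_config_space[OF B] by simp
qed auto

text \<open>Avoiding \<open>B\<close> and \<open>C\<close> means avoiding
  \<open>B \<union> C\<close>, so the generator is a pi-system; \<open>B = {}\<close> puts the whole
  space into it.\<close>

lemma void_space_measure_eqI:
  assumes "finite_measure P" "sets P = sets void_space" "sets Q = sets void_space"
    and "\<And>B. B \<in> sets borel \<Longrightarrow> bounded B \<Longrightarrow>
      emeasure P {S. loc_finite S \<and> S \<inter> B = {}} = emeasure Q {S. loc_finite S \<and> S \<inter> B = {}}"
  shows "P = Q"
proof (rule measure_eqI_generator_eq[where A = "\<lambda>_. {S. loc_finite S}" and \<Omega> = "{S. loc_finite S}"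
      and E = "{{S. loc_finite S \<and> S \<inter> B = {}} | B. B \<in> sets borel \<and> bounded B}"])
  show "Int_stable {{S. loc_finite S \<and> S \<inter> B = {}} | B :: (real^2) set. B \<in> sets borel \<and> bounded B}"
  proof (rule Int_stableI, clarify)
    fix B C :: "(real^2) set"
    assume "B \<in> sets borel" "bounded B" "C \<in> sets borel" "bounded C"
    then show "\<exists>D. {S. loc_finite S \<and> S \<inter> B = {}} \<inter> {S. loc_finite S \<and> S \<inter> C = {}}
        = {S. loc_finite S \<and> S \<inter> D = {}} \<and> D \<in> sets borel \<and> bounded D"
      by (intro exI[of _ "B \<union> C"]) auto
  qed
  show "emeasure P {S. loc_finite S} \<noteq> \<infinity>" for i :: nat
    using finite_measure.emeasure_finite[OF assms(1)] by simp
  show "range (\<lambda>_ :: nat. {S. loc_finite S})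
      \<subseteq> {{S. loc_finite S \<and> S \<inter> B = {}} | B. B \<in> sets borel \<and> bounded B}"
    by (auto intro!: exI[of _ "{}"])
qed (use assms in \<open>auto simp: sets_void_space\<close>)

section \<open>Measurability of the Voronoi cell and its area\<close>

text \<open>A locally finite set that avoids the closed disc about \<open>y\<close> through \<open>0\<close> also avoids
  a rational disc containing it.\<close>
lemma voronoi_cell_measurable:
  "{(y, E). loc_finite E \<and> y \<in> typical_voronoi_cell E} \<in> sets (borel \<Otimes>\<^sub>M void_space)"
proof -
  obtain D :: "(real^2) set" where D: "countable D"
    "\<And>X. open X \<Longrightarrow> X \<noteq> {} \<Longrightarrow> \<exists>d\<in>D. d \<in> X"
    using countable_dense_setE by blast
  let ?R = "\<lambda>q r. {y. dist y q + norm y \<le> r} \<times> {E. loc_finite E \<and> E \<inter> cball q r = {}}"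
  have "{(y, E). loc_finite E \<and> y \<in> typical_voronoi_cell E} = (\<Union>q\<in>D. \<Union>r\<in>\<rat>. ?R q r)"
    (is "?W = ?U")
  proof (intro equalityI subsetI)
    fix z assume "z \<in> ?W"
    then obtain y E where z: "z = (y, E)" and E: "loc_finite E"
      and y: "\<And>p. p \<in> E \<Longrightarrow> norm y < dist y p"
      by (auto simp: typical_voronoi_cell_def dist_norm)
    define F where "F = E \<inter> cball y (norm y + 1)"
    have F: "finite F"
      unfolding F_def by (rule loc_finiteD[OF E]) simp
    \<comment> \<open>The least excess of \<open>dist y p\<close> over \<open>norm y\<close> on the
      finite set \<open>F\<close>, capped at 1 because points of \<open>E\<close> outside
      \<open>F\<close> have excess above 1.\<close>
    define \<delta> where "\<delta> = Min (insert 1 ((\<lambda>p. dist y p - norm y) ` F))"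
    have \<delta>: "\<delta> > 0"
      unfolding \<delta>_def using F y by (subst Min_gr_iff) (auto simp: F_def)
    have away: "norm y + \<delta> \<le> dist y p" if "p \<in> E" for p
    proof (cases "p \<in> F")
      case True
      then have "\<delta> \<le> dist y p - norm y"
        unfolding \<delta>_def using F by (intro Min_le) auto
      then show ?thesis by simp
    next
      case False
      have "\<delta> \<le> 1"
        unfolding \<delta>_def using F by (intro Min_le) auto
      with False that show ?thesis by (auto simp: F_def)
    qed
    \<comment> \<open>The slack \<open>\<delta>\<close> is cut into thirds: \<open>q\<close> moves
      by less than one third and \<open>r\<close> lies in the middle third, so
      \<open>cball q r\<close> contains \<open>cball y (norm y)\<close> but misses every
      \<open>p\<close>.\<close>
    obtain q where q: "q \<in> D" "q \<in> ball y (\<delta>/3)"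
      using D(2)[of "ball y (\<delta>/3)"] \<delta> by auto
    obtain r where r: "r \<in> \<rat>" "norm y + \<delta>/3 < r" "r < norm y + 2*\<delta>/3"
      using Rats_dense_in_real[of "norm y + \<delta>/3" "norm y + 2*\<delta>/3"] \<delta> by auto
    have "p \<notin> cball q r" if "p \<in> E" for p
      using away[OF that] q(2) r dist_triangle[of y p q] by auto
    with q r E have "z \<in> ?R q r"
      unfolding z by auto
    with q(1) r(1) show "z \<in> ?U" by blast
  next
    fix z assume "z \<in> ?U"
    then obtain y E q r where z: "z = (y, E)" and E: "loc_finite E"
      and *: "dist y q + norm y \<le> r" "E \<inter> cball q r = {}"
      by auto
    have "norm y < norm (y - p)" if "p \<in> E" for p
    proof -
      have "r < dist q p" using * that by auto
      then show ?thesis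
        using *(1) dist_triangle[of q p y] unfolding dist_norm[symmetric] by (simp add: dist_commute)
    qed
    then show "z \<in> ?W"
      unfolding z using E by (auto simp: typical_voronoi_cell_def)
  qed
  moreover have "?R q r \<in> sets (borel \<Otimes>\<^sub>M void_space)" for q r
    by (intro pair_measureI void_event_void_space) simp_all
  ultimately show ?thesis
    using D(1) countable_rat by (auto intro!: sets.countable_UN')
qed

lemma voronoi_cell_borel:
  assumes "loc_finite E"
  shows "typical_voronoi_cell E \<in> sets borel"
proof -
  have "(\<lambda>y. (y, E)) -` {(y, E). loc_finite E \<and> y \<in> typical_voronoi_cell E} \<in> sets borel"
    using sets_Pair2[OF voronoi_cell_measurable] .
  then show ?thesis
    using assms by (simp add: vimage_def)
qed

lemma voronoi_emeasure_measurable: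
  "(\<lambda>E. emeasure lborel (typical_voronoi_cell E)) \<in> borel_measurable void_space"
proof -
  let ?W = "{(y, E). loc_finite E \<and> y \<in> typical_voronoi_cell E}"
  have "?W \<in> sets (lborel \<Otimes>\<^sub>M void_space)"
    using voronoi_cell_measurable sets_pair_measure_cong[OF sets_lborel refl] by blast
  \<comment> \<open>The factors are swapped so that \<open>lborel\<close> measures the
    sections.\<close>
  then have "(\<lambda>(E, y). (y, E)) -` ?W \<inter> space (void_space \<Otimes>\<^sub>M lborel)
      \<in> sets (void_space \<Otimes>\<^sub>M lborel)"
    by (rule measurable_sets[OF measurable_pair_swap'])
  from sigma_finite_measure.measurable_emeasure_Pair[OF sigma_finite_lborel this]
  show ?thesis
    by (rule measurable_cong[THEN iffD1, rotated])
      (auto simp: space_pair_measure intro!: arg_cong[where f = "emeasure lborel"])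
qed

lemma voronoi_area_measurable: "typical_voronoi_area \<in> borel_measurable void_space"
  unfolding typical_voronoi_area_def[abs_def] measure_def
  using voronoi_emeasure_measurable by measurable

section \<open>Measurability of point counts in random sets\<close>

text \<open>Dynkin argument in \<open>W\<close>, starting from rectangles. The window
  \<open>B\<close> keeps counts finite, so complements become differences; values in
  \<open>ennreal\<close> let disjoint unions become infinite sums.\<close>

lemma count_section_bounded_measurable:
  assumes W: "W \<in> sets (borel \<Otimes>\<^sub>M T)" and B: "B \<in> sets borel" "bounded B"
  shows "(\<lambda>(L, E). emeasure (count_space UNIV) (L \<inter> B \<inter> (\<lambda>y. (y, E)) -` W))
    \<in> borel_measurable (config_space \<Otimes>\<^sub>M T)"
proof -
  let ?f = "\<lambda>W z. emeasure (count_space UNIV) (fst z \<inter> B \<inter> (\<lambda>y. (y, snd z)) -` W)"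
  have fin: "finite (fst z \<inter> B \<inter> X)" if "z \<in> space (config_space \<Otimes>\<^sub>M T)" for z :: "(real^2) set \<times> 'a" and X
    using loc_finiteD[OF _ B(2)] that by (auto simp: space_pair_measure)
  have count: "(\<lambda>z. emeasure (count_space UNIV) (fst z \<inter> C)) \<in> borel_measurable (config_space \<Otimes>\<^sub>M T)"
    if C: "C \<in> sets borel" "bounded C" for C
  proof (subst measurable_cong)
    fix z assume "z \<in> space (config_space \<Otimes>\<^sub>M T)"
    then show "emeasure (count_space UNIV) (fst z \<inter> C) = of_nat (card (fst z \<inter> C))"
      using loc_finiteD[OF _ C(2)] by (auto simp: space_pair_measure)
  next
    show "(\<lambda>z. of_nat (card (fst z \<inter> C))) \<in> borel_measurable (config_space \<Otimes>\<^sub>M T)"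
      using measurable_compose[OF measurable_compose[OF measurable_fst measurable_count[OF C]], of of_nat borel]
      by simp
  qed
  have "W \<in> sigma_sets (space borel \<times> space T) {a \<times> b | a b. a \<in> sets borel \<and> b \<in> sets T}"
    using W unfolding sets_pair_measure .
  with Int_stable_pair_measure_generator pair_measure_closed
  have "?f W \<in> borel_measurable (config_space \<Otimes>\<^sub>M T)"
  proof (induct rule: sigma_sets_induct_disjoint)
    case (basic A)
    then obtain a b where A: "A = a \<times> b" and a: "a \<in> sets borel" and b: "b \<in> sets T"
      by auto
    have "?f A z = emeasure (count_space UNIV) (fst z \<inter> (B \<inter> a)) * indicator b (snd z)" for z
      unfolding A by (auto simp: indicator_def vimage_def Int_assoc)
    moreover have "(\<lambda>z. emeasure (count_space UNIV) (fst z \<inter> (B \<inter> a))) \<in> borel_measurable (config_space \<Otimes>\<^sub>M T)"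
      using a B by (intro count) (auto intro: bounded_subset)
    ultimately show ?case
      using b by simp
  next
    case empty
    then show ?case by simp
  next
    case (compl A)
    have "?f (space borel \<times> space T - A) z = emeasure (count_space UNIV) (fst z \<inter> B) - ?f A z"
      if z: "z \<in> space (config_space \<Otimes>\<^sub>M T)" for z
    proof -
      have "fst z \<inter> B \<inter> (\<lambda>y. (y, snd z)) -` (space borel \<times> space T - A)
          = fst z \<inter> B - fst z \<inter> B \<inter> (\<lambda>y. (y, snd z)) -` A"
        using z by (auto simp: space_pair_measure)
      then show ?thesis
        using fin[OF z, of "(\<lambda>y. (y, snd z)) -` A"]
        by (simp only:, subst emeasure_Diff) auto
    qed
    with compl count[OF B] show ?case
      by (subst measurable_cong[where g = "\<lambda>z. emeasure (count_space UNIV) (fst z \<inter> B) - ?f A z"]) auto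
  next
    case (union F)
    have "?f (\<Union>i. F i) z = (\<Sum>i. ?f (F i) z)" for z
    proof -
      have "disjoint_family (\<lambda>i. fst z \<inter> B \<inter> (\<lambda>y. (y, snd z)) -` F i)"
        using union(1) by (auto simp: disjoint_family_on_def)
      then show ?thesis
        by (subst suminf_emeasure) (auto simp: vimage_UN)
    qed
    with union show ?case by simp
  qed
  then show ?thesis by (simp add: case_prod_beta')
qed

text \<open>Discs about 0 exhaust the plane, and the count is the supremum of the counts within
  them.\<close>

lemma count_section_measurable:
  assumes W: "W \<in> sets (borel \<Otimes>\<^sub>M T)"
  shows "(\<lambda>(L, E). emeasure (count_space UNIV) (L \<inter> (\<lambda>y. (y, E)) -` W))
    \<in> borel_measurable (config_space \<Otimes>\<^sub>M T)"
proof -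
  have sup: "emeasure (count_space UNIV) (L \<inter> (\<lambda>y. (y, E)) -` W)
      = (SUP m. emeasure (count_space UNIV) (L \<inter> cball 0 (real m) \<inter> (\<lambda>y. (y, E)) -` W))" for L E
  proof -
    have "x \<in> cball 0 (real (nat \<lceil>norm x\<rceil>))" for x :: "real^2"
      by (simp add: real_nat_ceiling_ge)
    then have "L \<inter> (\<lambda>y. (y, E)) -` W = (\<Union>m. L \<inter> cball 0 (real m) \<inter> (\<lambda>y. (y, E)) -` W)"
      by blast
    then show ?thesis
      by (subst SUP_emeasure_incseq) (auto simp: incseq_def)
  qed
  have "(\<lambda>z. SUP m. emeasure (count_space UNIV) (fst z \<inter> cball 0 (real m) \<inter> (\<lambda>y. (y, snd z)) -` W))
      \<in> borel_measurable (config_space \<Otimes>\<^sub>M T)"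
    using count_section_bounded_measurable[OF W, of "cball 0 (real m)" for m]
    by (intro borel_measurable_SUP) (auto simp: case_prod_beta')
  then show ?thesis
    unfolding case_prod_beta' by (subst sup)
qed

section \<open>Moments and generating function of the Poisson distribution\<close>

text \<open>With \<open>?p k\<close> the falling factorial,
  \<open>x * ?p k = ?p (k + 1) + k * ?p k\<close> reproduces the recurrence of the Stirling
  numbers.\<close>

lemma power_eq_sum_Stirling:
  fixes x :: "'a :: comm_ring_1"
  shows "x ^ n = (\<Sum>k\<le>n. of_nat (Stirling n k) * (\<Prod>i<k. x - of_nat i))"
proof (induction n)
  case 0
  then show ?case by simp
next
  case (Suc n)
  let ?p = "\<lambda>k. \<Prod>i<k. x - of_nat i"
  \<comment> \<open>After the index shift the term at \<open>k = 0\<close> carries the factor 0, and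
    the one at \<open>Suc n\<close> vanishes because \<open>Stirling n (Suc n) = 0\<close>.\<close>
  have "(\<Sum>k\<le>n. of_nat (Suc k * Stirling n (Suc k)) * ?p (Suc k))
      = (\<Sum>k\<le>Suc n. of_nat (k * Stirling n k) * ?p k)"
    by (subst sum.atMost_Suc_shift) simp
  also have "\<dots> = (\<Sum>k\<le>n. of_nat (k * Stirling n k) * ?p k)"
    by simp
  finally have *: "(\<Sum>k\<le>n. of_nat (Suc k * Stirling n (Suc k)) * ?p (Suc k))
      = (\<Sum>k\<le>n. of_nat (k * Stirling n k) * ?p k)" .
  have "(\<Sum>k\<le>Suc n. of_nat (Stirling (Suc n) k) * ?p k)
      = (\<Sum>k\<le>n. of_nat (Suc k * Stirling n (Suc k)) * ?p (Suc k)) + (\<Sum>k\<le>n. of_nat (Stirling n k) * ?p (Suc k))"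
    by (subst sum.atMost_Suc_shift) (simp add: sum.distrib[symmetric] distrib_right del: prod.lessThan_Suc)
  also have "\<dots> = (\<Sum>k\<le>n. x * (of_nat (Stirling n k) * ?p k))"
    unfolding * sum.distrib[symmetric] by (intro sum.cong refl) (simp add: algebra_simps)
  also have "\<dots> = x ^ Suc n"
    unfolding sum_distrib_left[symmetric] Suc.IH[symmetric] by simp
  finally show ?case by simp
qed

text \<open>Generalising over \<open>j\<close> lets the last factor of the product, which equals
  \<open>j + 1\<close>, be absorbed into \<open>fact j\<close>.\<close>

lemma falling_factorial_mult_fact:
  "(\<Prod>i<k. real (j + k) - real i) * fact j = fact (j + k)"
proof (induction k arbitrary: j)
  case (Suc k)
  have "(\<Prod>i<Suc k. real (j + Suc k) - real i) * fact j
      = (\<Prod>i<k. real (Suc j + k) - real i) * fact (Suc j)"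
    by (simp add: algebra_simps)
  also have "\<dots> = fact (Suc j + k)" by (rule Suc.IH)
  finally show ?case by simp
qed simp

text \<open>The falling factorial cancels against \<open>fact (j + k)\<close>, which leaves
  \<open>\<mu> ^ k * exp (- \<mu>)\<close> times the exponential series.\<close>

lemma poisson_factorial_moment:
  fixes \<mu> :: real
  shows "(\<lambda>j. (\<Prod>i<k. real j - real i) * (\<mu> ^ j / fact j * exp (- \<mu>))) sums \<mu> ^ k"
proof -
  have "(\<lambda>j. \<mu> ^ j /\<^sub>R fact j * (\<mu> ^ k * exp (- \<mu>))) sums (exp \<mu> * (\<mu> ^ k * exp (- \<mu>)))"
    by (intro sums_mult2 exp_converges)
  also have "exp \<mu> * (\<mu> ^ k * exp (- \<mu>)) = \<mu> ^ k"
    by (simp add: exp_minus)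
  also have "(\<lambda>j. \<mu> ^ j /\<^sub>R fact j * (\<mu> ^ k * exp (- \<mu>)))
      = (\<lambda>j. (\<Prod>i<k. real (j + k) - real i) * (\<mu> ^ (j + k) / fact (j + k) * exp (- \<mu>)))"
  proof
    fix j
    have "(\<Prod>i<k. real (j + k) - real i) / fact (j + k) = 1 / fact j"
      using falling_factorial_mult_fact[of j k] by (simp add: field_simps)
    then have eq: "(\<Prod>i<k. real (j + k) - real i) * (\<mu> ^ (j + k) / fact (j + k) * exp (- \<mu>))
      = 1 / fact j * (\<mu> ^ (j + k) * exp (- \<mu>))"
      by (metis (no_types, lifting) times_divide_eq_left times_divide_eq_right)
    show "\<mu> ^ j /\<^sub>R fact j * (\<mu> ^ k * exp (- \<mu>))
      = (\<Prod>i<k. real (j + k) - real i) * (\<mu> ^ (j + k) / fact (j + k) * exp (- \<mu>))"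
      unfolding eq by (simp add: power_add field_simps)
  qed
  finally show ?thesis
    \<comment> \<open>Dropping the first \<open>k\<close> terms changes nothing: for
      \<open>j < k\<close> the product contains the factor at \<open>i = j\<close>, which is
      0.\<close>
    by (subst (asm) sums_zero_iff_shift) auto
qed

text \<open>Expanding \<open>j ^ n\<close> in falling factorials reduces this to factorial moments;
  \<open>n \<ge> 1\<close> removes the term at \<open>k = 0\<close>.\<close>

lemma poisson_moment:
  fixes \<mu> :: real
  assumes "n \<ge> 1"
  shows "(\<lambda>j. real j ^ n * (\<mu> ^ j / fact j * exp (- \<mu>))) sums (\<Sum>k=1..n. real (Stirling n k) * \<mu> ^ k)"
proof -
  have "(\<lambda>j. \<Sum>k\<le>n. real (Stirling n k) * ((\<Prod>i<k. real j - real i) * (\<mu> ^ j / fact j * exp (- \<mu>))))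
      sums (\<Sum>k\<le>n. real (Stirling n k) * \<mu> ^ k)"
    by (intro sums_sum sums_mult poisson_factorial_moment)
  moreover have "(\<Sum>k\<le>n. real (Stirling n k) * ((\<Prod>i<k. real j - real i) * (\<mu> ^ j / fact j * exp (- \<mu>))))
      = real j ^ n * (\<mu> ^ j / fact j * exp (- \<mu>))" for j
    unfolding power_eq_sum_Stirling[of "real j" n] sum_distrib_right by (simp add: mult.assoc)
  moreover have "(\<Sum>k\<le>n. real (Stirling n k) * \<mu> ^ k) = (\<Sum>k=1..n. real (Stirling n k) * \<mu> ^ k)"
  proof -
    have "Stirling n 0 = 0" using assms by (cases n) auto
    then show ?thesis
      by (simp add: atMost_atLeast0 sum.atLeast_Suc_atMost)
  qed
  ultimately show ?thesis by simp
qed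

text \<open>The factor \<open>exp (s * real j)\<close> turns the series into the exponential series
  at \<open>\<mu> * exp s\<close>.\<close>

lemma poisson_mgf:
  fixes \<mu> s :: real
  shows "(\<lambda>j. exp (s * real j) * (\<mu> ^ j / fact j * exp (- \<mu>))) sums exp (\<mu> * (exp s - 1))"
proof -
  have "(\<lambda>j. (\<mu> * exp s) ^ j /\<^sub>R fact j * exp (- \<mu>)) sums (exp (\<mu> * exp s) * exp (- \<mu>))"
    by (intro sums_mult2 exp_converges)
  moreover have "(\<mu> * exp s) ^ j /\<^sub>R fact j * exp (- \<mu>) = exp (s * real j) * (\<mu> ^ j / fact j * exp (- \<mu>))" for j
    by (simp add: power_mult_distrib exp_of_nat_mult[symmetric] field_simps)
  moreover have "exp (\<mu> * exp s) * exp (- \<mu>) = exp (\<mu> * (exp s - 1))"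
    by (simp add: exp_add[symmetric] algebra_simps)
  ultimately show ?thesis by simp
qed

section \<open>Counts and void events of Poisson processes\<close>

lemma poisson_process_measurable:
  "poisson_process M lam \<Phi> \<Longrightarrow> \<Phi> \<in> measurable M config_space"
  by (simp add: poisson_process_def)

lemma poisson_process_loc_finite:
  "poisson_process M lam \<Phi> \<Longrightarrow> \<omega> \<in> space M \<Longrightarrow> loc_finite (\<Phi> \<omega>)"
  using measurable_space[OF poisson_process_measurable] by fastforce

lemma poisson_process_count_measurable:
  assumes "poisson_process M lam \<Phi>" "B \<in> sets borel" "bounded B"
  shows "(\<lambda>\<omega>. card (\<Phi> \<omega> \<inter> B)) \<in> measurable M (count_space UNIV)"
  using measurable_compose[OF poisson_process_measurable[OF assms(1)] measurable_count[OF assms(2,3)]] .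

lemma poisson_process_void_measurable:
  assumes "poisson_process M lam \<Phi>"
  shows "\<Phi> \<in> measurable M void_space"
  using measurable_compose[OF poisson_process_measurable[OF assms] measurable_config_void] by simp

text \<open>Splitting by the value of the count gives a series over Poisson probabilities. General
  \<open>f\<close> and \<open>g\<close> serve both the generating function and the moments.\<close>

lemma poisson_process_nn_integral:
  assumes "prob_space M" "poisson_process M lam \<Phi>" "lam \<ge> 0"
    and B: "B \<in> sets borel" "bounded B"
    and f: "\<And>j. f j \<ge> 0"
    and g: "(\<lambda>j. f j * ((lam * measure lborel B) ^ j / fact j * exp (- (lam * measure lborel B)))) sums g"
  shows "(\<integral>\<^sup>+\<omega>. ennreal (f (card (\<Phi> \<omega> \<inter> B))) \<partial>M) = ennreal g"
proof -
  interpret prob_space M by fact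
  note meas = poisson_process_count_measurable[OF assms(2) B]
  let ?A = "\<lambda>j. {\<omega> \<in> space M. card (\<Phi> \<omega> \<inter> B) = j}"
  have A [measurable]: "?A j \<in> sets M" for j
    using measurable_sets[OF meas, of "{j}"] by (simp add: vimage_def Int_def conj_commute)
  have "(\<integral>\<^sup>+\<omega>. ennreal (f (card (\<Phi> \<omega> \<inter> B))) \<partial>M)
      = (\<integral>\<^sup>+\<omega>. (\<Sum>j. ennreal (f j) * indicator (?A j) \<omega>) \<partial>M)"
  proof (rule nn_integral_cong)
    fix \<omega> assume "\<omega> \<in> space M"
    then have "(\<Sum>j. ennreal (f j) * indicator (?A j) \<omega>)
        = (\<Sum>j\<in>{card (\<Phi> \<omega> \<inter> B)}. ennreal (f j) * indicator (?A j) \<omega>)"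
      by (intro suminf_finite) auto
    with \<open>\<omega> \<in> space M\<close> show "ennreal (f (card (\<Phi> \<omega> \<inter> B))) = (\<Sum>j. ennreal (f j) * indicator (?A j) \<omega>)"
      by simp
  qed
  also have "\<dots> = (\<Sum>j. \<integral>\<^sup>+\<omega>. ennreal (f j) * indicator (?A j) \<omega> \<partial>M)"
    by (intro nn_integral_suminf) measurable
  also have "\<dots> = (\<Sum>j. ennreal (f j * ((lam * measure lborel B) ^ j / fact j * exp (- (lam * measure lborel B)))))"
  proof (rule suminf_cong)
    fix j
    have "prob (?A j) = (lam * measure lborel B) ^ j / fact j * exp (- (lam * measure lborel B))"
      using assms(2) B unfolding poisson_process_def by blast
    then show "(\<integral>\<^sup>+\<omega>. ennreal (f j) * indicator (?A j) \<omega> \<partial>M)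
        = ennreal (f j * ((lam * measure lborel B) ^ j / fact j * exp (- (lam * measure lborel B))))"
      by (simp only: nn_integral_cmult_indicator[OF A] emeasure_eq_measure ennreal_mult'[OF f])
  qed
  also have "\<dots> = ennreal g"
    using f assms(3) g by (intro suminf_ennreal_eq) auto
  finally show ?thesis .
qed

lemma poisson_process_void_probability:
  assumes "poisson_process M lam \<Phi>" "B \<in> sets borel" "bounded B"
  shows "measure M {\<omega> \<in> space M. \<Phi> \<omega> \<inter> B = {}} = exp (- (lam * measure lborel B))"
proof -
  have "{\<omega> \<in> space M. \<Phi> \<omega> \<inter> B = {}} = {\<omega> \<in> space M. card (\<Phi> \<omega> \<inter> B) = 0}"
    using loc_finiteD[OF poisson_process_loc_finite[OF assms(1)] assms(3)] by auto
  moreover have "measure M {\<omega> \<in> space M. card (\<Phi> \<omega> \<inter> B) = 0} = exp (- (lam * measure lborel B))"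
    using assms unfolding poisson_process_def by simp
  ultimately show ?thesis by simp
qed

section \<open>Scaling to unit density\<close>

text \<open>Sets of infinite measure are covered too: both sides are then 0 by the default value of
  \<open>measure\<close>.\<close>

lemma measure_lborel_scaleR_vimage:
  fixes B :: "'a::euclidean_space set"
  assumes "c > 0" "B \<in> sets borel"
  shows "measure lborel B = c ^ DIM('a) * measure lborel ((\<lambda>x. c *\<^sub>R x) -` B)"
proof -
  have "emeasure lborel B = emeasure (density (distr lborel borel (\<lambda>x. c *\<^sub>R x)) (\<lambda>_. ennreal (c ^ DIM('a)))) B"
    using lborel_affine[of c "0::'a"] assms(1) by simp
  also have "\<dots> = ennreal (c ^ DIM('a)) * emeasure lborel ((\<lambda>x. c *\<^sub>R x) -` B)"
    using assms by (simp add: emeasure_density nn_integral_cmult_indicator emeasure_distr)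
  finally show ?thesis
    using assms(1) by (simp add: measure_def enn2real_mult)
qed

lemma typical_voronoi_cell_scaleR:
  assumes "c > 0"
  shows "(\<lambda>x. c *\<^sub>R x) -` typical_voronoi_cell ((\<lambda>x. c *\<^sub>R x) ` P) = typical_voronoi_cell P"
  using assms unfolding typical_voronoi_cell_def
  by (auto simp: scaleR_diff_right[symmetric])

lemma loc_finite_scaleR:
  assumes "c > 0" "loc_finite P"
  shows "loc_finite ((\<lambda>x. c *\<^sub>R x) ` P)"
  unfolding loc_finite_def
proof (intro allI impI)
  fix B :: "(real^2) set" assume "bounded B"
  then have "finite (P \<inter> (\<lambda>x. (1/c) *\<^sub>R x) ` B)"
    by (intro loc_finiteD[OF assms(2)] bounded_scaling)
  moreover have "(\<lambda>x. c *\<^sub>R x) ` P \<inter> B \<subseteq> (\<lambda>x. c *\<^sub>R x) ` (P \<inter> (\<lambda>x. (1/c) *\<^sub>R x) ` B)"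
    using assms(1) by (force simp: image_iff)
  ultimately show "finite ((\<lambda>x. c *\<^sub>R x) ` P \<inter> B)"
    by (meson finite_imageI finite_subset)
qed

lemma typical_voronoi_area_scaleR:
  assumes "c > 0" "loc_finite P"
  shows "typical_voronoi_area ((\<lambda>x. c *\<^sub>R x) ` P) = c\<^sup>2 * typical_voronoi_area P"
  using measure_lborel_scaleR_vimage[OF assms(1) voronoi_cell_borel[OF loc_finite_scaleR[OF assms]]]
    typical_voronoi_cell_scaleR[OF assms(1)]
  by (simp add: typical_voronoi_area_def)

text \<open>Scaling by \<open>1 / sqrt lam\<close> gives the unit-density process the void
  probabilities of density \<open>lam\<close>, and these fix the law on \<open>void_space\<close>.
  Measurability is stated as well because integrals are later moved along
  \<open>distr\<close>.\<close>

lemma distr_poisson_process_scaleR: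
  assumes "prob_space M" "prob_space M'" "lam > 0"
    and \<Phi>: "poisson_process M lam \<Phi>" and \<Psi>: "poisson_process M' 1 \<Psi>"
  shows "distr M void_space \<Phi> = distr M' void_space (\<lambda>\<omega>. (\<lambda>x. (1 / sqrt lam) *\<^sub>R x) ` \<Psi> \<omega>)"
    (is "_ = distr _ _ ?\<Psi>")
    and "(\<lambda>\<omega>. (\<lambda>x. (1 / sqrt lam) *\<^sub>R x) ` \<Psi> \<omega>) \<in> measurable M' void_space"
proof -
  interpret M: prob_space M by fact
  interpret M': prob_space M' by fact
  define c where "c = 1 / sqrt lam"
  have c: "c > 0" "c\<^sup>2 = 1 / lam"
    using assms(3) by (simp_all add: c_def power_divide)
  note \<Phi>v = poisson_process_void_measurable[OF \<Phi>] and \<Psi>v = poisson_process_void_measurable[OF \<Psi>]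
  have vim: "(\<lambda>x. c *\<^sub>R x) -` B \<in> sets borel" "bounded ((\<lambda>x. c *\<^sub>R x) -` B)"
    if "B \<in> sets borel" "bounded B" for B :: "(real^2) set"
  proof -
    show "(\<lambda>x. c *\<^sub>R x) -` B \<in> sets borel"
      using measurable_sets[of "\<lambda>x. c *\<^sub>R x" borel borel B] that(1) by simp
    have "(\<lambda>x. c *\<^sub>R x) -` B \<subseteq> (\<lambda>x. (1/c) *\<^sub>R x) ` B"
      using c(1) by (force simp: image_iff)
    then show "bounded ((\<lambda>x. c *\<^sub>R x) -` B)"
      using bounded_scaling[OF that(2)] bounded_subset by blast
  qed
  have void_iff: "(\<lambda>x. c *\<^sub>R x) ` S \<inter> B = {} \<longleftrightarrow> S \<inter> (\<lambda>x. c *\<^sub>R x) -` B = {}" for S B :: "(real^2) set"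
    by auto
  show meas: "?\<Psi> \<in> measurable M' void_space"
    unfolding void_space_def c_def[symmetric]
  proof (rule measurable_measure_of)
    fix X assume "X \<in> {{S. loc_finite S \<and> S \<inter> B = {}} | B. B \<in> sets borel \<and> bounded B}"
    then obtain B where B: "B \<in> sets borel" "bounded B" and X: "X = {S. loc_finite S \<and> S \<inter> B = {}}"
      by blast
    have "(\<lambda>\<omega>. (\<lambda>x. c *\<^sub>R x) ` \<Psi> \<omega>) -` X \<inter> space M'
        = \<Psi> -` {S. loc_finite S \<and> S \<inter> (\<lambda>x. c *\<^sub>R x) -` B = {}} \<inter> space M'"
      unfolding X using poisson_process_loc_finite[OF \<Psi>] loc_finite_scaleR[OF c(1)]
      by (auto simp: void_iff)
    then show "(\<lambda>\<omega>. (\<lambda>x. c *\<^sub>R x) ` \<Psi> \<omega>) -` X \<inter> space M' \<in> sets M'"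
      using measurable_sets[OF \<Psi>v void_event_void_space[OF vim[OF B]]] by simp
  qed (use poisson_process_loc_finite[OF \<Psi>] loc_finite_scaleR[OF c(1)] in auto)
  show "distr M void_space \<Phi> = distr M' void_space ?\<Psi>"
  proof (rule void_space_measure_eqI)
    show "finite_measure (distr M void_space \<Phi>)"
      by (intro prob_space.finite_measure M.prob_space_distr \<Phi>v)
    fix B :: "(real^2) set" assume B: "B \<in> sets borel" "bounded B"
    note ev = void_event_void_space[OF B]
    have "emeasure (distr M void_space \<Phi>) {S. loc_finite S \<and> S \<inter> B = {}}
        = emeasure M {\<omega> \<in> space M. \<Phi> \<omega> \<inter> B = {}}"
      using poisson_process_loc_finite[OF \<Phi>]
      by (subst emeasure_distr[OF \<Phi>v ev]) (auto intro!: arg_cong[where f = "emeasure M"])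
    also have "\<dots> = ennreal (exp (- (lam * measure lborel B)))"
      using poisson_process_void_probability[OF \<Phi> B] by (simp add: M.emeasure_eq_measure)
    \<comment> \<open>Dimension 2 enters here: pulling back along the scaling divides area by
      \<open>c\<^sup>2\<close>, which is \<open>1 / lam\<close>.\<close>
    also have "lam * measure lborel B = 1 * measure lborel ((\<lambda>x. c *\<^sub>R x) -` B)"
      using measure_lborel_scaleR_vimage[OF c(1) B(1)] c(2) assms(3) by simp
    also have "ennreal (exp (- (1 * measure lborel ((\<lambda>x. c *\<^sub>R x) -` B))))
        = emeasure M' {\<omega> \<in> space M'. \<Psi> \<omega> \<inter> (\<lambda>x. c *\<^sub>R x) -` B = {}}"
      using poisson_process_void_probability[OF \<Psi> vim[OF B]] by (simp add: M'.emeasure_eq_measure)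
    also have "\<dots> = emeasure (distr M' void_space ?\<Psi>) {S. loc_finite S \<and> S \<inter> B = {}}"
      using poisson_process_loc_finite[OF \<Psi>] loc_finite_scaleR[OF c(1)]
      by (subst emeasure_distr[OF meas ev])
        (auto simp: c_def[symmetric] void_iff intro!: arg_cong[where f = "emeasure M'"])
    finally show "emeasure (distr M void_space \<Phi>) {S. loc_finite S \<and> S \<inter> B = {}}
        = emeasure (distr M' void_space ?\<Psi>) {S. loc_finite S \<and> S \<inter> B = {}}" .
  qed simp_all
qed

section \<open>Almost sure boundedness of the cell\<close>

text \<open>Sign pattern of an open quadrant. The index type \<open>bool^2\<close> is finite, so
  almost sure statements about single quadrants combine into one.\<close>

definition orient :: "bool^2 \<Rightarrow> 2 \<Rightarrow> real" where
  "orient b i = (if b $ i then 1 else - 1)"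

text \<open>For \<open>y\<close> in the cell and \<open>p\<close> in the quadrant of
  \<open>y\<close>, being closer to 0 than to \<open>p\<close> gives
  \<open>2 * (y \<bullet> p) < p \<bullet> p\<close>. The inner product is a sum of nonnegative
  terms, so \<open>p\<close> bounds each coordinate of \<open>y\<close>.\<close>

lemma bounded_typical_voronoi_cell:
  assumes "\<And>b. \<exists>p\<in>E. \<forall>i. orient b i * p $ i > 0"
  shows "bounded (typical_voronoi_cell E)"
proof -
  obtain p where p: "\<And>b. p b \<in> E" "\<And>b i. orient b i * p b $ i > 0"
    using assms by metis
  \<comment> \<open>Summing over all quadrants and coordinates gives one bound for whichever
    \<open>p b\<close> applies to \<open>y\<close>.\<close>
  define R where "R = (\<Sum>b\<in>UNIV. \<Sum>i\<in>UNIV. (p b \<bullet> p b) / \<bar>p b $ i\<bar>)"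
  have "norm y \<le> 2 * R" if y: "y \<in> typical_voronoi_cell E" for y
  proof -
    \<comment> \<open>The quadrant of \<open>y\<close>; a zero coordinate may count as positive
      since it adds nothing to the inner product.\<close>
    define b :: "bool^2" where "b = (\<chi> i. y $ i \<ge> 0)"
    have sgn: "y $ i * p b $ i = \<bar>y $ i\<bar> * \<bar>p b $ i\<bar>" for i
    proof (cases "y $ i \<ge> 0")
      case True
      then show ?thesis using p(2)[of b i] by (simp add: orient_def b_def)
    next
      case False
      then have "p b $ i < 0" using p(2)[of b i] by (simp add: orient_def b_def)
      with False show ?thesis by simp
    qed
    have "(norm y)\<^sup>2 < (norm (y - p b))\<^sup>2"
      using y p(1)[of b] by (auto simp: typical_voronoi_cell_def intro!: power_strict_mono)
    then have "2 * (y \<bullet> p b) < p b \<bullet> p b"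
      by (simp add: power2_norm_eq_inner inner_diff inner_commute)
    moreover have "y \<bullet> p b = (\<Sum>i\<in>UNIV. \<bar>y $ i\<bar> * \<bar>p b $ i\<bar>)"
      by (simp add: inner_vec_def sgn)
    moreover have le: "\<bar>y $ i\<bar> * \<bar>p b $ i\<bar> \<le> (\<Sum>i\<in>UNIV. \<bar>y $ i\<bar> * \<bar>p b $ i\<bar>)" for i
      by (rule member_le_sum) auto
    moreover have "(\<Sum>i\<in>UNIV. \<bar>y $ i\<bar> * \<bar>p b $ i\<bar>) \<ge> 0"
      by (intro sum_nonneg) auto
    ultimately have *: "\<bar>y $ i\<bar> * \<bar>p b $ i\<bar> \<le> p b \<bullet> p b" for i
      using le[of i] by linarith
    have "\<bar>y $ i\<bar> \<le> R" for i
    proof -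
      have "\<bar>p b $ i\<bar> > 0"
        using p(2)[of b i] by auto
      then have "\<bar>y $ i\<bar> \<le> (p b \<bullet> p b) / \<bar>p b $ i\<bar>"
        using *[of i] by (simp add: field_simps)
      also have "\<dots> \<le> (\<Sum>i\<in>UNIV. (p b \<bullet> p b) / \<bar>p b $ i\<bar>)"
        by (rule member_le_sum) auto
      also have "\<dots> \<le> R"
        unfolding R_def by (rule member_le_sum) (auto intro!: sum_nonneg)
      finally show ?thesis .
    qed
    then have "(\<Sum>i\<in>UNIV. \<bar>y $ i\<bar>) \<le> (\<Sum>i\<in>(UNIV::2 set). R)"
      by (intro sum_mono)
    then show ?thesis
      using norm_le_l1_cart[of y] by simp
  qed
  then show ?thesis
    unfolding bounded_iff by blast
qed

text \<open>A square of side \<open>n\<close> in a quadrant is empty with probability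
  \<open>exp (- (lam * n\<^sup>2))\<close>, which tends to 0, so almost surely every quadrant is
  hit.\<close>

lemma poisson_process_bounded_cell:
  assumes "prob_space M" "lam > 0" and \<Phi>: "poisson_process M lam \<Phi>"
  shows "AE \<omega> in M. bounded (typical_voronoi_cell (\<Phi> \<omega>))"
proof -
  interpret prob_space M by fact
  have quadrant: "AE \<omega> in M. \<exists>p\<in>\<Phi> \<omega>. \<forall>i. orient b i * p $ i > 0" for b
  proof -
    \<comment> \<open>Open square with a corner at 0: coordinate \<open>i\<close> ranges over
      \<open>(0, n)\<close> or \<open>(-n, 0)\<close> according to
      \<open>orient b i\<close>.\<close>
    define Q :: "nat \<Rightarrow> (real^2) set" where
      "Q n = box (\<chi> i. real n / 2 * (orient b i - 1)) (\<chi> i. real n / 2 * (orient b i + 1))" for n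
    have Q: "Q n \<in> sets borel" "bounded (Q n)" for n
      unfolding Q_def by auto
    have Q_meas: "measure lborel (Q n) = (real n)\<^sup>2" for n
    proof -
      have "((\<chi> i. real n / 2 * (orient b i + 1)) - (\<chi> i. real n / 2 * (orient b i - 1))) \<bullet> k = real n"
        if "k \<in> Basis" for k :: "real^2"
        using that by (auto simp: Basis_vec_def inner_axis field_simps)
      then show ?thesis
        unfolding Q_def measure_lborel_box_eq by (auto simp: inner_diff_left) (smt (verit) of_nat_0_le_iff)
    qed
    have Q_pos: "orient b i * p $ i > 0" if "p \<in> Q n" for p n i
      using that by (auto simp: Q_def mem_box_cart orient_def split: if_splits dest!: spec[of _ i])
    \<comment> \<open>Void events concern bounded sets, so emptiness of the quadrant is expressed
      through the squares that exhaust it.\<close>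
    let ?H = "{\<omega> \<in> space M. \<forall>n. \<Phi> \<omega> \<inter> Q n = {}}"
    have ev: "{\<omega> \<in> space M. \<Phi> \<omega> \<inter> Q n = {}} \<in> sets M" for n
    proof -
      have eq: "\<Phi> -` {S. loc_finite S \<and> S \<inter> Q n = {}} \<inter> space M = {\<omega> \<in> space M. \<Phi> \<omega> \<inter> Q n = {}}"
        using poisson_process_loc_finite[OF \<Phi>] by auto
      show ?thesis
        using measurable_sets[OF poisson_process_void_measurable[OF \<Phi>] void_event_void_space[OF Q[of n]]]
        unfolding eq .
    qed
    have H: "?H \<in> sets M"
    proof -
      have "?H = (\<Inter>n. {\<omega> \<in> space M. \<Phi> \<omega> \<inter> Q n = {}})" by auto
      then show ?thesis using ev by auto
    qed
    have "prob ?H \<le> exp (- (lam * (real n)\<^sup>2))" for n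
    proof -
      have "prob ?H \<le> prob {\<omega> \<in> space M. \<Phi> \<omega> \<inter> Q n = {}}"
        by (intro finite_measure_mono ev) auto
      then show ?thesis
        using poisson_process_void_probability[OF \<Phi> Q] by (simp add: Q_meas)
    qed
    moreover have "(\<lambda>n. exp (- (lam * (real n)\<^sup>2))) \<longlonglongrightarrow> 0"
      using assms(2) by real_asymp
    ultimately have "prob ?H \<le> 0"
      by (intro LIMSEQ_le_const) auto
    then have "AE \<omega> in M. \<omega> \<notin> ?H"
      using prob_eq_0[OF H] by (simp add: measure_le_0_iff)
    then show ?thesis
    proof (rule AE_mp, intro AE_I2 impI)
      fix \<omega> assume "\<omega> \<in> space M" "\<omega> \<notin> ?H"
      then obtain n p where "p \<in> \<Phi> \<omega>" "p \<in> Q n" by auto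
      then show "\<exists>p\<in>\<Phi> \<omega>. \<forall>i. orient b i * p $ i > 0"
        using Q_pos by blast
    qed
  qed
  have "AE \<omega> in M. \<forall>b\<in>UNIV. \<exists>p\<in>\<Phi> \<omega>. \<forall>i. orient b i * p $ i > 0"
    using quadrant by (subst AE_finite_all) auto
  then show ?thesis
    by (rule AE_mp) (intro AE_I2 impI bounded_typical_voronoi_cell, simp)
qed

section \<open>The law of the in-degree\<close>

text \<open>The edge condition from \<open>x\<close> to 0 is membership of \<open>x\<close> in the
  cell. Removing 0 excludes the loop and thereby also the inserted node.\<close>

lemma typical_in_neighbours_eq:
  "typical_in_neighbours L E = L \<inter> (typical_voronoi_cell E - {0})"
  by (auto simp: typical_in_neighbours_def in_neighbours_def iS_graph_def typical_voronoi_cell_def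
      dist_norm)

lemma typical_in_degree_measurable:
  "(\<lambda>(L, E). typical_in_degree L E) \<in> measurable (config_space \<Otimes>\<^sub>M void_space) (count_space UNIV)"
proof -
  let ?W = "{(y, E). loc_finite E \<and> y \<in> typical_voronoi_cell E} - {0} \<times> {E. loc_finite E}"
  have "{0 :: real^2} \<times> space void_space \<in> sets (borel \<Otimes>\<^sub>M void_space)"
    by (intro pair_measureI sets.top) auto
  then have "?W \<in> sets (borel \<Otimes>\<^sub>M void_space)"
    using voronoi_cell_measurable by auto
  from count_section_measurable[OF this]
  have "(\<lambda>z. enn2real (emeasure (count_space UNIV) (fst z \<inter> (\<lambda>y. (y, snd z)) -` ?W)))
      \<in> borel_measurable (config_space \<Otimes>\<^sub>M void_space)"
    unfolding case_prod_beta' by measurable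
  \<comment> \<open>This also holds for infinite neighbourhoods: \<open>enn2real\<close> sends
    infinity to 0, and \<open>card\<close> is 0 on infinite sets.\<close>
  moreover have "enn2real (emeasure (count_space UNIV) (fst z \<inter> (\<lambda>y. (y, snd z)) -` ?W))
      = real (typical_in_degree (fst z) (snd z))" if "z \<in> space (config_space \<Otimes>\<^sub>M void_space)" for z
  proof -
    have "fst z \<inter> (\<lambda>y. (y, snd z)) -` ?W = typical_in_neighbours (fst z) (snd z)"
      using that by (auto simp: typical_in_neighbours_eq space_pair_measure)
    then show ?thesis
      by (cases "finite (typical_in_neighbours (fst z) (snd z))") (simp_all add: typical_in_degree_def)
  qed
  ultimately have "(\<lambda>z. real (typical_in_degree (fst z) (snd z))) \<in> borel_measurable (config_space \<Otimes>\<^sub>M void_space)"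
    by (subst (asm) measurable_cong) auto
  then have "(\<lambda>z. nat \<lfloor>real (typical_in_degree (fst z) (snd z))\<rfloor>) \<in> measurable (config_space \<Otimes>\<^sub>M void_space) (count_space UNIV)"
    by measurable
  then show ?thesis
    by (simp add: case_prod_beta')
qed

text \<open>Common form of both claims: \<open>g \<mu>\<close> is the expectation of
  \<open>f\<close> under the Poisson law of mean \<open>\<mu>\<close>. Fubini conditions on the
  eavesdroppers, and scaling then passes to unit density.\<close>

lemma expect_typical_in_degree:
  assumes "prob_space M" "prob_space M'" "lam_l > 0" "lam_e > 0"
    and L: "poisson_process M lam_l \<Phi>l" and E: "poisson_process M lam_e \<Phi>e"
    and indep: "prob_space.indep_var M config_space \<Phi>l config_space \<Phi>e"
    and U: "poisson_process M' 1 \<Phi>1"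
    and f: "\<And>j. f j \<ge> 0"
    and g: "\<And>\<mu>. \<mu> \<ge> 0 \<Longrightarrow> (\<lambda>j. f j * (\<mu> ^ j / fact j * exp (- \<mu>))) sums g \<mu>"
    and [measurable]: "g \<in> borel_measurable borel"
  shows "expect M (\<lambda>\<omega>. f (typical_in_degree (\<Phi>l \<omega>) (\<Phi>e \<omega>)))
    = expect M' (\<lambda>\<omega>. g (lam_l / lam_e * typical_voronoi_area (\<Phi>1 \<omega>)))"
proof -
  interpret M: prob_space M by fact
  note Lm = poisson_process_measurable[OF L] and Ev = poisson_process_void_measurable[OF E]
  note area [measurable] = voronoi_area_measurable
  let ?PL = "distr M config_space \<Phi>l" and ?PE = "distr M void_space \<Phi>e"
  let ?h = "\<lambda>z. ennreal (f (typical_in_degree (fst z) (snd z)))"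
  interpret PL: prob_space ?PL by (rule M.prob_space_distr[OF Lm])
  interpret PE: prob_space ?PE by (rule M.prob_space_distr[OF Ev])
  interpret PLE: pair_sigma_finite ?PL ?PE ..
  have h: "?h \<in> borel_measurable (config_space \<Otimes>\<^sub>M void_space)"
    using measurable_compose[OF typical_in_degree_measurable, of "\<lambda>n. ennreal (f n)" borel]
    by (simp add: case_prod_beta')
  have h': "?h \<in> borel_measurable (?PL \<Otimes>\<^sub>M ?PE)"
    using h by simp
  \<comment> \<open>Independence survives coarsening the second sigma-algebra.\<close>
  have "M.indep_var config_space \<Phi>l void_space \<Phi>e"
    using M.indep_var_compose[OF indep measurable_ident measurable_config_void] by (simp add: comp_def)
  then have joint: "?PL \<Otimes>\<^sub>M ?PE = distr M (config_space \<Otimes>\<^sub>M void_space) (\<lambda>\<omega>. (\<Phi>l \<omega>, \<Phi>e \<omega>))"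
    by (simp add: M.indep_var_distribution_eq)
  have "expect M (\<lambda>\<omega>. f (typical_in_degree (\<Phi>l \<omega>) (\<Phi>e \<omega>))) = (\<integral>\<^sup>+z. ?h z \<partial>(?PL \<Otimes>\<^sub>M ?PE))"
    unfolding expect_def joint using h by (subst nn_integral_distr[OF measurable_Pair[OF Lm Ev]]) simp_all
  also have "\<dots> = (\<integral>\<^sup>+S. (\<integral>\<^sup>+T. ?h (T, S) \<partial>?PL) \<partial>?PE)"
    using PLE.nn_integral_snd[OF h'] by simp
  also have "\<dots> = (\<integral>\<^sup>+\<omega>. (\<integral>\<^sup>+T. ?h (T, \<Phi>e \<omega>) \<partial>?PL) \<partial>M)"
  proof (rule nn_integral_distr[OF Ev])
    show "(\<lambda>S. \<integral>\<^sup>+T. ?h (T, S) \<partial>?PL) \<in> borel_measurable ?PE"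
      using PL.borel_measurable_nn_integral_fst[OF measurable_pair_swap[OF h']] by simp
  qed
  also have "\<dots> = (\<integral>\<^sup>+\<omega>. ennreal (g (lam_l * typical_voronoi_area (\<Phi>e \<omega>))) \<partial>M)"
  \<comment> \<open>Poisson counts are prescribed on bounded sets only, hence the appeal to almost
    sure boundedness of the cell.\<close>
  proof (rule nn_integral_cong_AE)
    show "AE \<omega> in M. (\<integral>\<^sup>+T. ?h (T, \<Phi>e \<omega>) \<partial>?PL) = ennreal (g (lam_l * typical_voronoi_area (\<Phi>e \<omega>)))"
      using poisson_process_bounded_cell[OF assms(1,4) E]
    proof (rule AE_mp, intro AE_I2 impI)
      fix \<omega> assume \<omega>: "\<omega> \<in> space M" and bdd: "bounded (typical_voronoi_cell (\<Phi>e \<omega>))"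
      let ?B = "typical_voronoi_cell (\<Phi>e \<omega>) - {0}"
      note lf = poisson_process_loc_finite[OF E \<omega>]
      have B: "?B \<in> sets borel" "bounded ?B"
        using voronoi_cell_borel[OF lf] bdd by (auto intro: bounded_subset)
      \<comment> \<open>Removing the origin does not change the area, as a point is a null
        set.\<close>
      have area_B: "measure lborel ?B = typical_voronoi_area (\<Phi>e \<omega>)"
        unfolding typical_voronoi_area_def using voronoi_cell_borel[OF lf]
        by (simp add: measure_def emeasure_Diff_null_set finite_imp_null_set_lborel)
      have sect: "(\<lambda>T. (T, \<Phi>e \<omega>)) \<in> measurable config_space (config_space \<Otimes>\<^sub>M void_space)"
        using lf by (intro measurable_Pair2') simp
      have "(\<integral>\<^sup>+T. ?h (T, \<Phi>e \<omega>) \<partial>?PL) = (\<integral>\<^sup>+\<omega>'. ennreal (f (card (\<Phi>l \<omega>' \<inter> ?B))) \<partial>M)"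
        using measurable_compose[OF sect h]
        by (subst nn_integral_distr[OF Lm]) (auto simp: typical_in_degree_def typical_in_neighbours_eq)
      also have "\<dots> = ennreal (g (lam_l * measure lborel ?B))"
        using assms(3) by (intro poisson_process_nn_integral[OF assms(1) L _ B f] g) auto
      finally show "(\<integral>\<^sup>+T. ?h (T, \<Phi>e \<omega>) \<partial>?PL) = ennreal (g (lam_l * typical_voronoi_area (\<Phi>e \<omega>)))"
        unfolding area_B .
    qed
  qed
  \<comment> \<open>The integrand now depends on \<open>\<Phi>e\<close> only through its law on
    \<open>void_space\<close>, which is that of the scaled \<open>\<Phi>1\<close>.\<close>
  also have "\<dots> = (\<integral>\<^sup>+S. ennreal (g (lam_l * typical_voronoi_area S)) \<partial>?PE)"
    by (rule nn_integral_distr[OF Ev, symmetric]) measurable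
  also have "\<dots> = (\<integral>\<^sup>+\<omega>. ennreal (g (lam_l * typical_voronoi_area ((\<lambda>x. (1 / sqrt lam_e) *\<^sub>R x) ` \<Phi>1 \<omega>))) \<partial>M')"
    unfolding distr_poisson_process_scaleR(1)[OF assms(1,2,4) E U]
    by (rule nn_integral_distr[OF distr_poisson_process_scaleR(2)[OF assms(1,2,4) E U]]) measurable
  also have "\<dots> = expect M' (\<lambda>\<omega>. g (lam_l / lam_e * typical_voronoi_area (\<Phi>1 \<omega>)))"
    unfolding expect_def
  proof (rule nn_integral_cong)
    fix \<omega> assume "\<omega> \<in> space M'"
    then have "typical_voronoi_area ((\<lambda>x. (1 / sqrt lam_e) *\<^sub>R x) ` \<Phi>1 \<omega>) = typical_voronoi_area (\<Phi>1 \<omega>) / lam_e"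
      using assms(4) by (subst typical_voronoi_area_scaleR[OF _ poisson_process_loc_finite[OF U]])
        (simp_all add: power_divide)
    then show "ennreal (g (lam_l * typical_voronoi_area ((\<lambda>x. (1 / sqrt lam_e) *\<^sub>R x) ` \<Phi>1 \<omega>)))
        = ennreal (g (lam_l / lam_e * typical_voronoi_area (\<Phi>1 \<omega>)))"
      by simp
  qed
  finally show ?thesis .
qed

theorem theorem3p1:
  fixes M :: "'w measure" and M' :: "'v measure"
    and \<Phi>l \<Phi>e :: "'w \<Rightarrow> (real^2) set" and \<Phi>1 :: "'v \<Rightarrow> (real^2) set"
    and lam_l lam_e :: real and N :: "'w \<Rightarrow> nat" and A :: "'v \<Rightarrow> real"
  assumes "prob_space M"
    and "lam_l > 0" and "lam_e > 0"
    and "poisson_process M lam_l \<Phi>l"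
    and "poisson_process M lam_e \<Phi>e"
    and "prob_space.indep_var M config_space \<Phi>l config_space \<Phi>e"
    and "prob_space M'"
    and "poisson_process M' 1 \<Phi>1"
    and N_def: "\<And>\<omega>. N \<omega> = typical_in_degree (\<Phi>l \<omega>) (\<Phi>e \<omega>)"
    and A_def: "\<And>\<omega>. A \<omega> = typical_voronoi_area (\<Phi>1 \<omega>)"
  shows
    \<comment> \<open>\<open>N\<close> and \<open>A\<close> are random variables, and almost surely \<open>card\<close> and \<open>measure\<close> in their
      definitions are not applied to an infinite in-neighbourhood or a cell of infinite area\<close>
    "N \<in> measurable M (count_space UNIV) \<and>
     (AE \<omega> in M. finite (typical_in_neighbours (\<Phi>l \<omega>) (\<Phi>e \<omega>))) \<and>
     A \<in> borel_measurable M' \<and>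
     (AE \<omega> in M'. emeasure lborel (typical_voronoi_cell (\<Phi>1 \<omega>)) < \<infinity>) \<and>
     (\<forall>s::real. mgf M (\<lambda>\<omega>. real (N \<omega>)) s =
        expect M' (\<lambda>\<omega>. exp (lam_l / lam_e * A \<omega> * (exp s - 1)))) \<and>
     (\<forall>n\<ge>1. expect M (\<lambda>\<omega>. real (N \<omega>) ^ n) =
        (\<Sum>k=1..n. ennreal ((lam_l / lam_e) ^ k * real (Stirling n k)) * expect M' (\<lambda>\<omega>. A \<omega> ^ k)))"
proof (intro conjI allI impI)
  interpret M: prob_space M by fact
  interpret M': prob_space M' by fact
  note expect_N = expect_typical_in_degree[OF assms(1,7,2,3,4,5,6,8)]
  show "N \<in> measurable M (count_space UNIV)"
    unfolding N_def[abs_def]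
    using measurable_compose[OF measurable_Pair[OF poisson_process_measurable[OF assms(4)]
          poisson_process_void_measurable[OF assms(5)]] typical_in_degree_measurable]
    by (simp add: N_def)
  show "AE \<omega> in M. finite (typical_in_neighbours (\<Phi>l \<omega>) (\<Phi>e \<omega>))"
    using poisson_process_bounded_cell[OF assms(1,3,5)]
  proof (rule AE_mp, intro AE_I2 impI)
    fix \<omega> assume "\<omega> \<in> space M" "bounded (typical_voronoi_cell (\<Phi>e \<omega>))"
    then show "finite (typical_in_neighbours (\<Phi>l \<omega>) (\<Phi>e \<omega>))"
      unfolding typical_in_neighbours_eq
      by (intro loc_finiteD[OF poisson_process_loc_finite[OF assms(4)]]) (auto intro: bounded_subset)
  qed
  show A_meas: "A \<in> borel_measurable M'"
    using measurable_compose[OF poisson_process_void_measurable[OF assms(8)] voronoi_area_measurable]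
    by (simp add: A_def cong: measurable_cong)
  show "AE \<omega> in M'. emeasure lborel (typical_voronoi_cell (\<Phi>1 \<omega>)) < \<infinity>"
    using poisson_process_bounded_cell[OF assms(7) _ assms(8)]
    by (auto elim!: eventually_mono dest: emeasure_bounded_finite)
  \<comment> \<open>The Poisson generating function is evaluated at the random mean
    \<open>lam_l / lam_e * A \<omega>\<close>.\<close>
  show "mgf M (\<lambda>\<omega>. real (N \<omega>)) s = expect M' (\<lambda>\<omega>. exp (lam_l / lam_e * A \<omega> * (exp s - 1)))" for s
    unfolding mgf_def N_def A_def
    by (rule expect_N[where f = "\<lambda>j. exp (s * real j)" and g = "\<lambda>\<mu>. exp (\<mu> * (exp s - 1))"])
      (use poisson_mgf[of s] in simp_all)
  fix n :: nat assume n: "1 \<le> n"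
  have A_nonneg: "A \<omega> \<ge> 0" for \<omega>
    by (simp add: A_def typical_voronoi_area_def)
  have "expect M (\<lambda>\<omega>. real (N \<omega>) ^ n)
      = expect M' (\<lambda>\<omega>. \<Sum>k=1..n. real (Stirling n k) * (lam_l / lam_e * A \<omega>) ^ k)"
    unfolding N_def A_def
    by (rule expect_N[where f = "\<lambda>j. real j ^ n" and g = "\<lambda>\<mu>. \<Sum>k=1..n. real (Stirling n k) * \<mu> ^ k"])
      (use poisson_moment[OF n] in simp_all)
  also have "\<dots> = (\<integral>\<^sup>+\<omega>. (\<Sum>k=1..n. ennreal ((lam_l / lam_e) ^ k * real (Stirling n k)) * ennreal (A \<omega> ^ k)) \<partial>M')"
    unfolding expect_def
  proof (rule nn_integral_cong)
    fix \<omega>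
    define r where "r = lam_l / lam_e"
    have r: "r \<ge> 0" using assms(2,3) by (simp add: r_def)
    have "ennreal (\<Sum>k=1..n. real (Stirling n k) * (r * A \<omega>) ^ k)
        = (\<Sum>k=1..n. ennreal (real (Stirling n k) * (r * A \<omega>) ^ k))"
      using r A_nonneg by (intro sum_ennreal[symmetric]) simp
    also have "\<dots> = (\<Sum>k=1..n. ennreal (r ^ k * real (Stirling n k)) * ennreal (A \<omega> ^ k))"
    proof (rule sum.cong[OF refl])
      fix k
      have "real (Stirling n k) * (r * A \<omega>) ^ k = (r ^ k * real (Stirling n k)) * A \<omega> ^ k"
        by (simp add: power_mult_distrib)
      then show "ennreal (real (Stirling n k) * (r * A \<omega>) ^ k)
          = ennreal (r ^ k * real (Stirling n k)) * ennreal (A \<omega> ^ k)"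
        using r A_nonneg by (simp only: ennreal_mult''[OF zero_le_power])
    qed
    finally show "ennreal (\<Sum>k=1..n. real (Stirling n k) * (lam_l / lam_e * A \<omega>) ^ k)
        = (\<Sum>k=1..n. ennreal ((lam_l / lam_e) ^ k * real (Stirling n k)) * ennreal (A \<omega> ^ k))"
      unfolding r_def .
  qed
  \<comment> \<open>All terms are nonnegative, so the expectation splits in \<open>ennreal\<close>
    even if a moment is infinite.\<close>
  also have "\<dots> = (\<Sum>k=1..n. ennreal ((lam_l / lam_e) ^ k * real (Stirling n k)) * expect M' (\<lambda>\<omega>. A \<omega> ^ k))"
    using A_meas unfolding expect_def by (simp add: nn_integral_sum nn_integral_cmult)
  finally show "expect M (\<lambda>\<omega>. real (N \<omega>) ^ n)
      = (\<Sum>k=1..n. ennreal ((lam_l / lam_e) ^ k * real (Stirling n k)) * expect M' (\<lambda>\<omega>. A \<omega> ^ k))" .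
qed

end
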